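(* For any superport circuit (that is, a superport network together with real numbers $\Delta U_{k,\mathrm{root}(k)}$ assigned to all non-root boundary vertices $k$), there exist a unique collection of real numbers $I_{kl}$, $1\le k,l\le n$, and a unique (up to adding the same constant to all of them) collection of real numbers $U_k$, $1\le k\le n$, that satisfy the following conditions, where $I_k:=\sum_{l=1}^n I_{kl}$: (C) $I_{kl}=c_{kl}(U_k-U_l)$ for each ordered pair of vertices $k,l$; (I) $\sum_{l=1}^n I_{kl}=0$ for each vertex $k>m$; (P) $\sum_{k\in A_i}I_k=0$ for each $i=1,\dots,p-1$; (B) $U_k-U_{\mathrm{root}(k)}=\Delta U_{k,\mathrm{root}(k)}$ for each non-root boundary vertex $k$.
   Context: A superport network with $p\ge 1$ superports is a finite connected graph (without loops or multiple edges) together with non-empty pairwise disjoint sets $A_1,\dots,A_p$ of vertices (superports) and a positive number (conductance) assigned to each edge. Vertices in $M:=A_1\cup\dots\cup A_p$ are called boundary, the others interior; $m:=|M|$. The vertices are numbered $1,\dots,n$ so that $A_1=\{1,\dots,|A_1|\}$, $A_2=\{|A_1|+1,\dots,|A_1|+|A_2|\}$, and so on; thus $M=\{1,\dots,m\}$. Let $c_{kl}=c_{lk}$ be the conductance of the edge $kl$, with $c_{kl}=0$ if there is no such edge (in particular $c_{kk}=0$). The root of a superport is its vertex with the maximal number, and $\mathrm{root}(k)$ is the root of the superport containing the boundary vertex $k$; the other boundary vertices are called non-root. *)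

theory Defs
  imports Complex_Main "HOL-Library.Disjoint_Sets" "Graph_Theory.Digraph_Component"
    "Graph_Theory.Pair_Digraph"
begin

(* A pair_graph is a finite simple graph: each undirected edge kl is represented by the two
   arcs (k,l) and (l,k), so the conductance of the edge is a symmetric function on arcs. *)
locale superport_network = pair_graph G
  for G :: "nat pair_pre_digraph" +
  fixes n p :: nat
    and A :: "nat \<Rightarrow> nat set"
    and c :: "nat \<Rightarrow> nat \<Rightarrow> real"
  assumes verts_numbering: "pverts G = {1..n}"
    and graph_connected: "Digraph_Component.connected (with_proj G)"
    and p_ge_1: "p \<ge> 1"
    and superport_subset: "i \<in> {1..p} \<Longrightarrow> A i \<subseteq> pverts G"
    and superport_nonempty: "i \<in> {1..p} \<Longrightarrow> A i \<noteq> {}"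
    and superports_disjoint: "disjoint_family_on A {1..p}"
    and superports_consecutive:
      "i \<in> {1..p} \<Longrightarrow> A i = {(\<Sum>j\<in>{1..<i}. card (A j)) + 1 .. \<Sum>j\<in>{1..i}. card (A j)}"
    and conductance_sym: "k \<in> pverts G \<Longrightarrow> l \<in> pverts G \<Longrightarrow> c k l = c l k"
    and conductance_pos: "(k, l) \<in> parcs G \<Longrightarrow> c k l > 0"
    and conductance_non_edge:
      "k \<in> pverts G \<Longrightarrow> l \<in> pverts G \<Longrightarrow> (k, l) \<notin> parcs G \<Longrightarrow> c k l = 0"
begin

definition boundary :: "nat set" where
  "boundary = (\<Union>i\<in>{1..p}. A i)"

definition m :: nat where
  "m = card boundary"

definition superport_index :: "nat \<Rightarrow> nat" where
  "superport_index k = (THE i. i \<in> {1..p} \<and> k \<in> A i)"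

definition root_of :: "nat \<Rightarrow> nat" where
  "root_of k = Max (A (superport_index k))"

definition nonroot :: "nat set" where
  "nonroot = {k \<in> boundary. k \<noteq> root_of k}"

(* dU k is the prescribed difference between k and the root of its superport; only its values
   on nonroot are used.  Likewise, only the values of I and U at vertices matter. *)
definition circuit_solution ::
  "(nat \<Rightarrow> real) \<Rightarrow> (nat \<Rightarrow> nat \<Rightarrow> real) \<Rightarrow> (nat \<Rightarrow> real) \<Rightarrow> bool" where
  "circuit_solution dU I U \<longleftrightarrow>
     (\<forall>k\<in>{1..n}. \<forall>l\<in>{1..n}. I k l = c k l * (U k - U l)) \<and>
     (\<forall>k\<in>{1..n}. k > m \<longrightarrow> (\<Sum>l\<in>{1..n}. I k l) = 0) \<and>
     (\<forall>i\<in>{1..<p}. (\<Sum>k\<in>A i. \<Sum>l\<in>{1..n}. I k l) = 0) \<and>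
     (\<forall>k\<in>nonroot. U k - U (root_of k) = dU k)"

end

end

theory Submission
  imports Defs "Jordan_Normal_Form.Determinant"
begin

text \<open>
  Adjoin the normalisation \<open>U r = 0\<close> at the root \<open>r\<close> of the last superport. Counting one
  equation per vertex (at an interior vertex (I), at a non-root boundary vertex (B), at the root of
  \<open>A i\<close> with \<open>i < p\<close> the equation (P), at \<open>r\<close> the normalisation), this is a square linear system
  for \<open>U\<close>, so it suffices to see that its homogeneous version has only the trivial solution. If
  \<open>dU = 0\<close>, then \<open>U\<close> is constant on each superport; since all currents add up to \<open>0\<close>, (P) also
  holds for \<open>i = p\<close>. So every superport, and every interior vertex, contributes \<open>0\<close> to the sum of
  \<open>U k * I k\<close>, which is half the sum of
  \<open>c k l * (U k - U l)\<^sup>2\<close>. Hence \<open>U\<close> is constant along edges, and the network is connected.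
\<close>

section \<open>Linear algebra: square systems with trivial kernel\<close>

text \<open>Enumerating \<open>S\<close> turns the coefficients into a square matrix. A trivial
  kernel makes its determinant non-zero, and its inverse applied to the right-hand side gives the
  solution.\<close>

lemma square_system_solvable:
  fixes a :: "'i \<Rightarrow> 'i \<Rightarrow> 'k :: field"
  assumes "finite S"
    and inj: "\<And>x. (\<forall>i\<in>S. (\<Sum>j\<in>S. a i j * x j) = 0) \<Longrightarrow> \<forall>j\<in>S. x j = 0"
  shows "\<exists>x. \<forall>i\<in>S. (\<Sum>j\<in>S. a i j * x j) = b i"
proof -
  define N where "N = card S"
  obtain h where h: "bij_betw h {0..<N} S"
    using ex_bij_betw_nat_finite[OF \<open>finite S\<close>] unfolding N_def by blast
  \<comment> \<open>\<open>g\<close> inverts the enumeration \<open>h\<close>, so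
    \<open>v $ g j\<close> reads a vector as a function on \<open>S\<close>.\<close>
  define g where "g = the_inv_into {0..<N} h"
  have gh: "g (h i) = i" if "i < N" for i
    unfolding g_def using h that by (simp add: bij_betw_def the_inv_into_f_f)
  have hg: "\<exists>i<N. k = h i" if "k \<in> S" for k
    using h that unfolding bij_betw_def by force
  define M where "M = mat N N (\<lambda>(i, j). a (h i) (h j))"
  have M: "M \<in> carrier_mat N N" by (simp add: M_def)
  have Mv: "(M *\<^sub>v v) $ i = (\<Sum>j\<in>S. a (h i) j * v $ g j)"
    if "v \<in> carrier_vec N" "i < N" for v i
  proof -
    have "(M *\<^sub>v v) $ i = (\<Sum>j\<in>{0..<N}. a (h i) (h j) * v $ g (h j))"
      using that by (simp add: M_def scalar_prod_def gh)
    then show ?thesis using sum.reindex_bij_betw[OF h, of "\<lambda>j. a (h i) j * v $ g j"] by simp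
  qed
  have "det M \<noteq> 0"
  proof
    assume "det M = 0"
    then obtain v where v: "v \<in> carrier_vec N" "v \<noteq> 0\<^sub>v N" "M *\<^sub>v v = 0\<^sub>v N"
      using det_0_iff_vec_prod_zero_field[OF M] by blast
    have "\<forall>i\<in>S. (\<Sum>j\<in>S. a i j * v $ g j) = 0"
      using hg Mv[OF v(1)] v(3) by (metis index_zero_vec(1))
    then have "\<forall>j\<in>S. v $ g j = 0" by (rule inj)
    then have "v $ i = 0" if "i < N" for i
      using that gh h by (metis atLeast0LessThan bij_betw_apply lessThan_iff)
    then show False using v(1,2) by auto
  qed
  then have "M \<in> Units (ring_mat TYPE('k) N ())" by (rule det_non_zero_imp_unit[OF M])
  then obtain B where B: "B \<in> carrier_mat N N" "M * B = 1\<^sub>m N"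
    by (auto simp: Units_def ring_mat_def)
  define w where "w = vec N (\<lambda>i. b (h i))"
  have w: "w \<in> carrier_vec N" by (simp add: w_def)
  have "M *\<^sub>v (B *\<^sub>v w) = w"
    using assoc_mult_mat_vec[OF M B(1) w] B(2) w by simp
  then have "\<forall>i\<in>S. (\<Sum>j\<in>S. a i j * (B *\<^sub>v w) $ g j) = b i"
    using hg Mv[of "B *\<^sub>v w"] B(1) w by (metis index_vec mult_mat_vec_carrier w_def)
  then show ?thesis by (intro exI[where x = "\<lambda>j. (B *\<^sub>v w) $ g j"])
qed

text \<open>This form avoids writing out coefficients: the values of \<open>F\<close> on the
  standard basis vectors \<open>e j\<close> are the columns of the matrix, and additivity with
  homogeneity recovers \<open>F\<close> from them.\<close>

lemma injective_linear_solvable: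
  fixes F :: "('i \<Rightarrow> 'k :: field) \<Rightarrow> 'i \<Rightarrow> 'k"
  assumes "finite S"
    and add: "\<And>x y i. i \<in> S \<Longrightarrow> F (\<lambda>j. x j + y j) i = F x i + F y i"
    and scale: "\<And>s x i. i \<in> S \<Longrightarrow> F (\<lambda>j. s * x j) i = s * F x i"
    and cong: "\<And>x y i. i \<in> S \<Longrightarrow> (\<And>j. j \<in> S \<Longrightarrow> x j = y j) \<Longrightarrow> F x i = F y i"
    and inj: "\<And>x. (\<forall>i\<in>S. F x i = 0) \<Longrightarrow> \<forall>j\<in>S. x j = 0"
  shows "\<exists>x. \<forall>i\<in>S. F x i = b i"
proof -
  define e :: "'i \<Rightarrow> 'i \<Rightarrow> 'k" where "e = (\<lambda>j k. if k = j then 1 else 0)"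
  have sum: "F (\<lambda>k. \<Sum>j\<in>T. x j * e j k) i = (\<Sum>j\<in>T. F (e j) i * x j)"
    if "finite T" "i \<in> S" for T x i
    using that(1)
  proof (induction T rule: finite_induct)
    case empty
    show ?case using scale[OF that(2), of 0 "\<lambda>_. 0"] by simp
  next
    case (insert j T)
    then show ?case using add[OF that(2)] scale[OF that(2)] by (simp add: mult.commute)
  qed
  have F: "F x i = (\<Sum>j\<in>S. F (e j) i * x j)" if "i \<in> S" for x i
  proof -
    \<comment> \<open>The basis expansion agrees with \<open>x\<close> only on \<open>S\<close>,
      which is why \<open>cong\<close> is required.\<close>
    have "F x i = F (\<lambda>k. \<Sum>j\<in>S. x j * e j k) i"
      using that \<open>finite S\<close> by (intro cong) (simp_all add: e_def if_distrib cong: if_cong)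
    then show ?thesis using sum[OF \<open>finite S\<close> that] by simp
  qed
  have "\<exists>x. \<forall>i\<in>S. (\<Sum>j\<in>S. F (e j) i * x j) = b i"
    using \<open>finite S\<close> inj by (intro square_system_solvable) (simp_all add: F)
  then show ?thesis by (simp add: F)
qed

text \<open>Split the square as \<open>U k * (U k - U l) + U l * (U l - U k)\<close>. By symmetry of
  \<open>c\<close>, exchanging \<open>k\<close> and \<open>l\<close> identifies the two resulting
  double sums.\<close>

lemma dirichlet_form:
  fixes U :: "'i \<Rightarrow> real"
  assumes "\<And>k l. k \<in> S \<Longrightarrow> l \<in> S \<Longrightarrow> c k l = c l k"
  shows "(\<Sum>k\<in>S. \<Sum>l\<in>S. c k l * (U k - U l)\<^sup>2) = 2 * (\<Sum>k\<in>S. U k * (\<Sum>l\<in>S. c k l * (U k - U l)))"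
proof -
  have *: "(\<Sum>k\<in>S. \<Sum>l\<in>S. U l * (c k l * (U l - U k))) =
        (\<Sum>k\<in>S. \<Sum>l\<in>S. U k * (c k l * (U k - U l)))"
    by (subst sum.swap) (intro sum.cong refl, simp add: assms)
  have "(\<Sum>k\<in>S. \<Sum>l\<in>S. c k l * (U k - U l)\<^sup>2) =
      (\<Sum>k\<in>S. \<Sum>l\<in>S. U k * (c k l * (U k - U l))) + (\<Sum>k\<in>S. \<Sum>l\<in>S. U l * (c k l * (U l - U k)))"
    unfolding sum.distrib[symmetric]
    by (intro sum.cong refl) (simp add: power2_eq_square algebra_simps)
  then show ?thesis by (simp add: * sum_distrib_left)
qed

section \<open>Connectedness, superports and the vertex numbering\<close>

context superport_network
begin

lemma conductance_nonneg: "k \<in> {1..n} \<Longrightarrow> l \<in> {1..n} \<Longrightarrow> c k l \<ge> 0"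
  using conductance_pos[of k l] conductance_non_edge[of k l] verts_numbering by fastforce

text \<open>Arcs come in opposite pairs, so connectedness gives a directed path from
  \<open>u\<close> to \<open>v\<close>; the equality propagates along it.\<close>

lemma edge_constant_imp_constant:
  assumes edge: "\<And>k l. (k, l) \<in> parcs G \<Longrightarrow> f k = f l"
    and "u \<in> {1..n}" "v \<in> {1..n}"
  shows "f u = f v"
proof -
  have "strongly_connected (with_proj G)"
    using symmetric_connected_imp_strongly_connected pair_sym_arcs graph_connected by blast
  then have "u \<rightarrow>\<^sup>*\<^bsub>with_proj G\<^esub> v"
    using assms(2,3) verts_numbering by (auto simp: strongly_connected_def)
  then show ?thesis
    by (induction rule: reachable_induct) (auto simp: edge)
qed

lemma superport_index_eq: "i \<in> {1..p} \<Longrightarrow> k \<in> A i \<Longrightarrow> superport_index k = i"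
  unfolding superport_index_def
  using superports_disjoint by (intro the_equality) (auto dest: disjoint_family_onD)

lemma finite_superport: "i \<in> {1..p} \<Longrightarrow> finite (A i)"
  using superport_subset verts_numbering by (metis finite_atLeastAtMost finite_subset)

lemma root_of_eq: "i \<in> {1..p} \<Longrightarrow> k \<in> A i \<Longrightarrow> root_of k = Max (A i)"
  by (simp add: root_of_def superport_index_eq)

lemma Max_superport: "i \<in> {1..p} \<Longrightarrow> Max (A i) \<in> A i"
  using finite_superport superport_nonempty by simp

lemma boundaryE:
  assumes "k \<in> boundary"
  obtains i where "i \<in> {1..p}" "k \<in> A i"
  using assms unfolding boundary_def by blast

lemma Max_superport_root:
  assumes "i \<in> {1..p}"
  shows "Max (A i) \<in> boundary" "Max (A i) \<notin> nonroot"
  using assms Max_superport[OF assms] root_of_eq[OF assms, of "Max (A i)"]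
  unfolding boundary_def nonroot_def by (blast, simp)

lemma boundary_subset: "boundary \<subseteq> {1..n}"
  unfolding boundary_def using superport_subset verts_numbering by blast

text \<open>Each superport starts right after the previous one ends, so the intervals glue together.
  With \<open>q = p\<close> this turns the condition \<open>k > m\<close> into not lying on the
  boundary.\<close>

lemma union_superports:
  "q \<le> p \<Longrightarrow> (\<Union>i\<in>{1..q}. A i) = {1..\<Sum>j\<in>{1..q}. card (A j)}"
proof (induction q)
  case (Suc q)
  have "A (Suc q) = {(\<Sum>j\<in>{1..q}. card (A j)) + 1 .. \<Sum>j\<in>{1..Suc q}. card (A j)}"
    using superports_consecutive[of "Suc q"] Suc.prems atLeastLessThanSuc_atLeastAtMost by simp
  moreover have "(\<Union>i\<in>{1..Suc q}. A i) = (\<Union>i\<in>{1..q}. A i) \<union> A (Suc q)"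
    by (simp add: atLeastAtMostSuc_conv Un_commute)
  moreover have "{1..a} \<union> {a + 1..b} = {1..b}" if "a \<le> b" for a b :: nat
    using that by auto
  moreover have "(\<Sum>j\<in>{1..q}. card (A j)) \<le> (\<Sum>j\<in>{1..Suc q}. card (A j))"
    by simp
  ultimately show ?case using Suc by (metis Suc_leD)
qed simp

lemma boundary_eq: "boundary = {1..m}"
  using union_superports[of p] by (simp add: m_def boundary_def)

lemma interior_iff: "k \<in> {1..n} \<Longrightarrow> k > m \<longleftrightarrow> k \<notin> boundary"
  by (auto simp: boundary_eq)

lemma sum_vertices_split:
  fixes f :: "nat \<Rightarrow> 'b :: comm_monoid_add"
  shows "(\<Sum>k\<in>{1..n}. f k) = (\<Sum>k\<in>{1..n} - boundary. f k) + (\<Sum>i\<in>{1..p}. \<Sum>k\<in>A i. f k)"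
proof -
  have "(\<Sum>k\<in>boundary. f k) = (\<Sum>i\<in>{1..p}. \<Sum>k\<in>A i. f k)"
    unfolding boundary_def using finite_superport superports_disjoint
    by (intro sum.UNION_disjoint) (auto simp: disjoint_family_on_def)
  then show ?thesis
    using sum.subset_diff[OF boundary_subset, of f] by simp
qed

section \<open>Currents and the system for the potentials alone\<close>

text \<open>This is the weighted graph Laplacian of \<open>U\<close>; under (C) it is the current
  I_k.\<close>

definition current :: "(nat \<Rightarrow> real) \<Rightarrow> nat \<Rightarrow> real" where
  "current U k = (\<Sum>l\<in>{1..n}. c k l * (U k - U l))"

text \<open>The current from \<open>k\<close> to \<open>l\<close> is antisymmetric, so exchanging
  the summations shows that the total is its own negative.\<close>

lemma sum_current: "(\<Sum>k\<in>{1..n}. current U k) = 0"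
proof -
  have "(\<Sum>k\<in>{1..n}. current U k) = (\<Sum>k\<in>{1..n}. \<Sum>l\<in>{1..n}. - (c k l * (U k - U l)))"
    unfolding current_def
    by (subst sum.swap) (intro sum.cong refl, use conductance_sym verts_numbering in
        \<open>simp add: algebra_simps\<close>)
  also have "\<dots> = - (\<Sum>k\<in>{1..n}. current U k)"
    by (simp add: current_def sum_negf)
  finally show ?thesis by simp
qed

text \<open>What remains of (I), (P) and (B) once (C) has eliminated the edge currents.\<close>

definition potential_solution :: "(nat \<Rightarrow> real) \<Rightarrow> (nat \<Rightarrow> real) \<Rightarrow> bool" where
  "potential_solution dU U \<longleftrightarrow>
     (\<forall>k\<in>{1..n} - boundary. current U k = 0) \<and>
     (\<forall>i\<in>{1..<p}. (\<Sum>k\<in>A i. current U k) = 0) \<and>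
     (\<forall>k\<in>nonroot. U k - U (root_of k) = dU k)"

lemma circuit_solution_iff:
  "circuit_solution dU I U \<longleftrightarrow>
     (\<forall>k\<in>{1..n}. \<forall>l\<in>{1..n}. I k l = c k l * (U k - U l)) \<and> potential_solution dU U"
proof -
  have *: "(\<Sum>l\<in>{1..n}. I k l) = current U k"
    if "\<forall>k\<in>{1..n}. \<forall>l\<in>{1..n}. I k l = c k l * (U k - U l)" "k \<in> {1..n}" for k
    using that by (simp add: current_def)
  have A: "(\<Sum>k\<in>A i. \<Sum>l\<in>{1..n}. I k l) = (\<Sum>k\<in>A i. current U k)"
    if "\<forall>k\<in>{1..n}. \<forall>l\<in>{1..n}. I k l = c k l * (U k - U l)" "i \<in> {1..<p}" for i
    using that superport_subset[of i] verts_numbering * by (intro sum.cong) auto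
  show ?thesis
    unfolding circuit_solution_def potential_solution_def
    using * A interior_iff by (smt (verit) Diff_iff)
qed

section \<open>Uniqueness up to a constant\<close>

lemma homogeneous_constant:
  assumes "potential_solution (\<lambda>_. 0) U" "u \<in> {1..n}" "v \<in> {1..n}"
  shows "U u = U v"
proof -
  have I: "current U k = 0" if "k \<in> {1..n} - boundary" for k
    using assms(1) that by (auto simp: potential_solution_def)
  have P: "(\<Sum>k\<in>A i. current U k) = 0" if "i \<in> {1..<p}" for i
    using assms(1) that by (auto simp: potential_solution_def)
  \<comment> \<open>In the vanishing total current every summand except that of \<open>A p\<close>
    is already known to be 0.\<close>
  have "{1..p} = insert p {1..<p}" using p_ge_1 by auto
  then have "(\<Sum>k\<in>A p. current U k) = 0"
    using sum_current[of U] sum_vertices_split[of "current U"] I P by simp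
  then have P: "(\<Sum>k\<in>A i. current U k) = 0" if "i \<in> {1..p}" for i
    using P that by (cases "i = p") auto
  have B: "U k = U (Max (A i))" if "i \<in> {1..p}" "k \<in> A i" for i k
  proof (cases "k \<in> nonroot")
    case True
    then show ?thesis
      using assms(1) that root_of_eq by (auto simp: potential_solution_def)
  next
    case False
    then show ?thesis using that root_of_eq by (auto simp: nonroot_def boundary_def)
  qed
  have "(\<Sum>k\<in>A i. U k * current U k) = 0" if "i \<in> {1..p}" for i
  proof -
    \<comment> \<open>By (B) with zero data the potential is constant on \<open>A i\<close> and
      factors out, leaving the sum in (P).\<close>
    have "(\<Sum>k\<in>A i. U k * current U k) = (\<Sum>k\<in>A i. U (Max (A i)) * current U k)"
      using B[OF that] by (intro sum.cong) auto
    then show ?thesis using P[OF that] by (simp flip: sum_distrib_left)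
  qed
  then have "(\<Sum>k\<in>{1..n}. U k * current U k) = 0"
    using I sum_vertices_split[of "\<lambda>k. U k * current U k"] by simp
  then have 0: "(\<Sum>k\<in>{1..n}. \<Sum>l\<in>{1..n}. c k l * (U k - U l)\<^sup>2) = 0"
    using dirichlet_form[of "{1..n}" c U] conductance_sym verts_numbering
    by (simp add: current_def)
  have "c k l * (U k - U l)\<^sup>2 = 0" if "k \<in> {1..n}" "l \<in> {1..n}" for k l
  proof -
    \<comment> \<open>All terms are non-negative, so first each row sum and then each single term
      vanishes.\<close>
    have "\<forall>k\<in>{1..n}. (\<Sum>l\<in>{1..n}. c k l * (U k - U l)\<^sup>2) = 0"
      using conductance_nonneg 0 by (subst (asm) sum_nonneg_eq_0_iff) (auto intro!: sum_nonneg)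
    then show ?thesis
      using that conductance_nonneg[OF that(1)]
        sum_nonneg_eq_0_iff[of "{1..n}" "\<lambda>l. c k l * (U k - U l)\<^sup>2"] by auto
  qed
  then have "U k = U l" if "(k, l) \<in> parcs G" for k l
    using conductance_pos[OF that] in_arcsD1[OF that] in_arcsD2[OF that] verts_numbering
    by fastforce
  then show ?thesis using assms(2,3) by (rule edge_constant_imp_constant)
qed

section \<open>Linearity and invariance under shifts\<close>

lemma current_add: "current (\<lambda>k. U k + V k) k = current U k + current V k"
  by (simp add: current_def algebra_simps flip: sum.distrib)

lemma current_scale: "current (\<lambda>k. s * U k) k = s * current U k"
  by (simp add: current_def sum_distrib_left algebra_simps)

lemma current_cong:
  "(\<And>l. l \<in> {1..n} \<Longrightarrow> U l = V l) \<Longrightarrow> k \<in> {1..n} \<Longrightarrow> current U k = current V k"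
  by (simp add: current_def)

lemma potential_solution_diff:
  assumes "potential_solution dU U" "potential_solution dU V"
  shows "potential_solution (\<lambda>_. 0) (\<lambda>k. U k - V k)"
proof -
  have "current (\<lambda>k. U k - V k) k = current U k - current V k" for k
    by (simp add: current_def algebra_simps flip: sum_subtractf)
  moreover have "U k - V k = U (root_of k) - V (root_of k)" if "k \<in> nonroot" for k
    using assms that unfolding potential_solution_def by fastforce
  ultimately show ?thesis
    using assms by (simp add: potential_solution_def sum_subtractf)
qed

lemma root_of_vertex: "k \<in> boundary \<Longrightarrow> root_of k \<in> {1..n}"
  by (metis Max_superport_root(1) boundaryE boundary_subset root_of_eq subsetD)

lemma potential_solution_shift:
  assumes "potential_solution dU U" "\<And>k. k \<in> {1..n} \<Longrightarrow> V k = U k + a"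
  shows "potential_solution dU V"
proof -
  have "current V k = current U k" if "k \<in> {1..n}" for k
    using assms(2) that by (simp add: current_def)
  moreover have "(\<Sum>k\<in>A i. current V k) = (\<Sum>k\<in>A i. current U k)" if "i \<in> {1..<p}" for i
    using that calculation superport_subset[of i] verts_numbering by (intro sum.cong) auto
  moreover have "k \<in> {1..n} \<and> root_of k \<in> {1..n}" if "k \<in> nonroot" for k
    using that root_of_vertex boundary_subset by (auto simp: nonroot_def)
  ultimately show ?thesis
    using assms by (auto simp: potential_solution_def)
qed

section \<open>Existence via the grounded square system\<close>

text \<open>Left-hand sides indexed by vertices, so that equations and unknowns match in number: (P)
  for a superport is stored at its root, and the root of \<open>A p\<close> carries the
  normalisation instead.\<close>

definition grounded_system :: "(nat \<Rightarrow> real) \<Rightarrow> nat \<Rightarrow> real" where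
  "grounded_system U k =
     (if k \<notin> boundary then current U k
      else if k \<in> nonroot then U k - U (root_of k)
      else if superport_index k = p then U k
      else (\<Sum>j\<in>A (superport_index k). current U j))"

lemma grounded_system_solution:
  assumes "\<forall>k\<in>{1..n}. grounded_system U k = (if k \<in> nonroot then dU k else 0)"
  shows "potential_solution dU U" "U (Max (A p)) = 0"
proof -
  have *: "grounded_system U (Max (A i)) = 0"
    "superport_index (Max (A i)) = i" if "i \<in> {1..p}" for i
    using that assms Max_superport_root[OF that] boundary_subset Max_superport superport_index_eq
    by auto
  have "(\<Sum>j\<in>A i. current U j) = 0" if "i \<in> {1..<p}" for i
    using that *[of i] Max_superport_root[of i] by (simp add: grounded_system_def)
  moreover have "current U k = 0" if "k \<in> {1..n} - boundary" for k
    using that assms[rule_format, of k] by (simp add: grounded_system_def nonroot_def)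
  moreover have "U k - U (root_of k) = dU k" if "k \<in> nonroot" for k
  proof -
    have "k \<in> boundary" using that by (simp add: nonroot_def)
    then show ?thesis
      using that assms[rule_format, of k] boundary_subset by (auto simp: grounded_system_def)
  qed
  ultimately show "potential_solution dU U" by (simp add: potential_solution_def)
  show "U (Max (A p)) = 0"
    using p_ge_1 *[of p] Max_superport_root[of p] by (simp add: grounded_system_def)
qed

lemma potential_solution_exists: "\<exists>U. potential_solution dU U"
proof -
  have "\<exists>U. \<forall>k\<in>{1..n}. grounded_system U k = (if k \<in> nonroot then dU k else 0)"
  proof (rule injective_linear_solvable)
    fix U V :: "nat \<Rightarrow> real" and k
    assume k: "k \<in> {1..n}" and eq: "\<And>j. j \<in> {1..n} \<Longrightarrow> U j = V j"
    \<comment> \<open>Off the boundary \<open>superport_index k\<close> is unspecified, so the claim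
      is restricted to boundary vertices, whose superport consists of vertices.\<close>
    have "(\<Sum>j\<in>A (superport_index k). current U j) = (\<Sum>j\<in>A (superport_index k). current V j)"
      if "k \<in> boundary"
    proof -
      have "A (superport_index k) \<subseteq> {1..n}"
        using that superport_index_eq superport_subset verts_numbering by (metis boundaryE)
      then show ?thesis using current_cong[of U V] eq by (intro sum.cong) auto
    qed
    then show "grounded_system U k = grounded_system V k"
      using k eq root_of_vertex[of k] current_cong[of U V] by (simp add: grounded_system_def)
  next
    \<comment> \<open>Trivial kernel: a homogeneous solution is constant on the vertices, and its
      value at the root of \<open>A p\<close> is 0.\<close>
    fix U
    assume "\<forall>k\<in>{1..n}. grounded_system U k = 0"
    then have *: "potential_solution (\<lambda>_. 0) U" "U (Max (A p)) = 0"
      using grounded_system_solution[of U "\<lambda>_. 0"] by auto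
    have "Max (A p) \<in> {1..n}"
      using p_ge_1 Max_superport_root[of p] boundary_subset by auto
    then show "\<forall>k\<in>{1..n}. U k = 0"
      using homogeneous_constant[OF *(1)] *(2) by metis
  qed (simp_all add: grounded_system_def current_add current_scale sum.distrib
        sum_distrib_left algebra_simps)
  then show ?thesis using grounded_system_solution(1) by blast
qed

end

theorem theorem4p6:
  fixes G :: "nat pair_pre_digraph" and n p :: nat and A :: "nat \<Rightarrow> nat set"
    and c :: "nat \<Rightarrow> nat \<Rightarrow> real" and dU :: "nat \<Rightarrow> real"
  assumes "superport_network G n p A c"
  shows "\<exists>I U. superport_network.circuit_solution n p A c dU I U \<and>
           (\<forall>I' U'. superport_network.circuit_solution n p A c dU I' U' \<longleftrightarrow>
              (\<forall>k\<in>{1..n}. \<forall>l\<in>{1..n}. I' k l = I k l) \<and>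
              (\<exists>a. \<forall>k\<in>{1..n}. U' k = U k + a))"
proof -
  interpret superport_network G n p A c by fact
  obtain U where U: "potential_solution dU U" using potential_solution_exists by blast
  define I where "I k l = c k l * (U k - U l)" for k l
  have shift: "\<exists>a. \<forall>k\<in>{1..n}. V k = U k + a" if "potential_solution dU V" for V
  proof (intro exI ballI)
    fix k assume k: "k \<in> {1..n}"
    \<comment> \<open>Vertex 1 serves as reference point; it exists because \<open>k\<close> lies in
      \<open>{1..n}\<close>.\<close>
    have "V k - U k = V 1 - U 1"
      using homogeneous_constant[OF potential_solution_diff[OF that U] k, of 1] k by simp
    then show "V k = U k + (V 1 - U 1)" by simp
  qed
  have "circuit_solution dU I U"
    using U by (simp add: circuit_solution_iff I_def)
  moreover have "circuit_solution dU I' U' \<longleftrightarrow>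
      (\<forall>k\<in>{1..n}. \<forall>l\<in>{1..n}. I' k l = I k l) \<and> (\<exists>a. \<forall>k\<in>{1..n}. U' k = U k + a)" for I' U'
  proof
    assume sol: "circuit_solution dU I' U'"
    then obtain a where "\<forall>k\<in>{1..n}. U' k = U k + a"
      using shift circuit_solution_iff by blast
    with sol show "(\<forall>k\<in>{1..n}. \<forall>l\<in>{1..n}. I' k l = I k l) \<and>
        (\<exists>a. \<forall>k\<in>{1..n}. U' k = U k + a)"
      by (auto simp: circuit_solution_iff I_def)
  next
    assume *: "(\<forall>k\<in>{1..n}. \<forall>l\<in>{1..n}. I' k l = I k l) \<and> (\<exists>a. \<forall>k\<in>{1..n}. U' k = U k + a)"
    then have "potential_solution dU U'"
      using potential_solution_shift[OF U] by blast
    with * show "circuit_solution dU I' U'"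
      by (auto simp: circuit_solution_iff I_def)
  qed
  ultimately show ?thesis by blast
qed

end
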